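(* Let $n\ge 1$, let $m=\lfloor n/2\rfloor$, and let $\mu^\ast$ be the polarized matching of the cyclic Hollow-Shell $C_n$, given by $\mu^\ast(i)=i$ for $0\le i<m$, $\mu^\ast(m)=n-1$, and $\mu^\ast(i)=i-1$ for $m<i\le n-1$. Then $$B_{C_n}(\mu^\ast)=m(n-1-m)=\left\lfloor\frac{(n-1)^2}{4}\right\rfloor ,$$ so $\beta(C_n)\ge\lfloor (n-1)^2/4\rfloor$. Moreover, the set of blocking pairs of $\mu^\ast$ (as pairs (index of man, index of woman)) is exactly the rectangle $\{m+1,\dots,n-1\}\times\{0,\dots,m-1\}$.
   Context: An instance $S$ of size $n$ consists of $n$ men $m_0,\dots,m_{n-1}$ and $n$ women $w_0,\dots,w_{n-1}$, each with a strict complete preference order on the other side. A complete matching is a bijection $\mu$ from men to women, written as a bijection of indices $\{0,\dots,n-1\}$. $(m_i,w_j)$ blocks $\mu$ if $m_i$ strictly prefers $w_j$ to his partner under $\mu$ and $w_j$ strictly prefers $m_i$ to her partner under $\mu$; $B_S(\mu)$ is the number of blocking pairs and $\beta(S)=\max_\mu B_S(\mu)$. $r_M(g,h)$ is the rank (1 is best) of woman $h$ in man $g$'s list and $r_W(h,g)$ the rank of man $g$ in woman $h$'s list. The cyclic Hollow-Shell $C_n$ is the instance with $r_M(g,h)=((h-g)\bmod n)+1$ and $r_W(h,g)=n-((h-g)\bmod n)$, where $\bmod\ n$ takes values in $\{0,\dots,n-1\}$. *)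

theory Defs imports Main begin

text \<open>Men and women of an instance of size \<open>n\<close> are represented by their indices in \<open>{..<n}\<close>.
  \<open>(h, h') \<in> man_pref S g\<close> means that man \<open>g\<close> strictly prefers woman \<open>h\<close> to woman \<open>h'\<close>;
  dually for \<open>woman_pref\<close>.\<close>

record sm_instance =
  size_of :: nat
  man_pref :: "nat \<Rightarrow> nat rel"
  woman_pref :: "nat \<Rightarrow> nat rel"

definition strict_pref_on :: "nat \<Rightarrow> nat rel \<Rightarrow> bool" where
  "strict_pref_on n r \<longleftrightarrow> r \<subseteq> {..<n} \<times> {..<n} \<and> strict_linear_order_on {..<n} r"

definition wf_instance :: "sm_instance \<Rightarrow> bool" where
  "wf_instance S \<longleftrightarrow>
     (\<forall>g<size_of S. strict_pref_on (size_of S) (man_pref S g)) \<and>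
     (\<forall>h<size_of S. strict_pref_on (size_of S) (woman_pref S h))"

definition rank_in :: "nat rel \<Rightarrow> nat \<Rightarrow> nat" where
  "rank_in r x = card {y. (y, x) \<in> r} + 1"

definition man_rank :: "sm_instance \<Rightarrow> nat \<Rightarrow> nat \<Rightarrow> nat" where
  "man_rank S g h = rank_in (man_pref S g) h"

definition woman_rank :: "sm_instance \<Rightarrow> nat \<Rightarrow> nat \<Rightarrow> nat" where
  "woman_rank S h g = rank_in (woman_pref S h) g"

text \<open>A matching maps men to women; its values outside \<open>{..<size_of S}\<close> are irrelevant.\<close>

definition complete_matching :: "sm_instance \<Rightarrow> (nat \<Rightarrow> nat) \<Rightarrow> bool" where
  "complete_matching S \<mu> \<longleftrightarrow> bij_betw \<mu> {..<size_of S} {..<size_of S}"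

definition man_of :: "sm_instance \<Rightarrow> (nat \<Rightarrow> nat) \<Rightarrow> nat \<Rightarrow> nat" where
  "man_of S \<mu> j = inv_into {..<size_of S} \<mu> j"

definition blocking_pairs :: "sm_instance \<Rightarrow> (nat \<Rightarrow> nat) \<Rightarrow> (nat \<times> nat) set" where
  "blocking_pairs S \<mu> =
     {(i, j). i < size_of S \<and> j < size_of S \<and>
        (j, \<mu> i) \<in> man_pref S i \<and> (i, man_of S \<mu> j) \<in> woman_pref S j}"

definition num_blocking :: "sm_instance \<Rightarrow> (nat \<Rightarrow> nat) \<Rightarrow> nat" where
  "num_blocking S \<mu> = card (blocking_pairs S \<mu>)"

definition max_blocking :: "sm_instance \<Rightarrow> nat" where
  "max_blocking S = Max {num_blocking S \<mu> | \<mu>. complete_matching S \<mu>}"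

lemma finite_num_blocking_values: "finite {num_blocking S \<mu> | \<mu>. complete_matching S \<mu>}"
proof (rule finite_subset)
  show "{num_blocking S \<mu> | \<mu>. complete_matching S \<mu>} \<subseteq> {..size_of S * size_of S}"
  proof clarsimp
    fix \<mu>
    have "blocking_pairs S \<mu> \<subseteq> {..<size_of S} \<times> {..<size_of S}"
      by (auto simp: blocking_pairs_def)
    from card_mono[OF _ this] show "num_blocking S \<mu> \<le> size_of S * size_of S"
      by (simp add: num_blocking_def)
  qed
qed simp

text \<open>The strict order on \<open>{..<n}\<close> induced by prescribed ranks \<open>f\<close>.\<close>

definition order_of_ranks :: "nat \<Rightarrow> (nat \<Rightarrow> nat) \<Rightarrow> nat rel" where
  "order_of_ranks n f = {(x, y). x < n \<and> y < n \<and> f x < f y}"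

lemma strict_pref_on_order_of_ranks:
  assumes "inj_on f {..<n}"
  shows "strict_pref_on n (order_of_ranks n f)"
  using assms
  by (auto simp: strict_pref_on_def order_of_ranks_def strict_linear_order_on_def
      trans_def irrefl_def total_on_def inj_on_def) (metis lessThan_iff linorder_neqE_nat)

lemma rank_in_order_of_ranks:
  assumes f: "bij_betw f {..<n} {1..n}" and x: "x < n"
  shows "rank_in (order_of_ranks n f) x = f x"
proof -
  have inj: "inj_on f {..<n}" and im: "f ` {..<n} = {1..n}"
    using f by (auto simp: bij_betw_def)
  have fx: "f x \<in> {1..n}" using im x by blast
  have "f ` {y. y < n \<and> f y < f x} = {1..<f x}"
  proof
    show "f ` {y. y < n \<and> f y < f x} \<subseteq> {1..<f x}" using im by force
    show "{1..<f x} \<subseteq> f ` {y. y < n \<and> f y < f x}"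
    proof
      fix k assume k: "k \<in> {1..<f x}"
      then have "k \<in> f ` {..<n}" using im fx by auto
      then show "k \<in> f ` {y. y < n \<and> f y < f x}" using k by auto
    qed
  qed
  moreover have "card (f ` {y. y < n \<and> f y < f x}) = card {y. y < n \<and> f y < f x}"
    by (rule card_image, rule inj_on_subset[OF inj]) auto
  ultimately have "card {y. y < n \<and> f y < f x} = f x - 1" by simp
  then show ?thesis using x fx by (simp add: rank_in_def order_of_ranks_def)
qed

definition cyc_diff :: "nat \<Rightarrow> nat \<Rightarrow> nat \<Rightarrow> nat" where
  "cyc_diff n g h = nat ((int h - int g) mod int n)"

text \<open>The cyclic Hollow-Shell is specified by its rank functions; the lemmas below show that
  these are indeed the ranks in the resulting instance.\<close>

definition hollow_shell :: "nat \<Rightarrow> sm_instance" where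
  "hollow_shell n =
     \<lparr>size_of = n,
      man_pref = (\<lambda>g. order_of_ranks n (\<lambda>h. cyc_diff n g h + 1)),
      woman_pref = (\<lambda>h. order_of_ranks n (\<lambda>g. n - cyc_diff n g h))\<rparr>"

lemma cyc_diff_less: "n > 0 \<Longrightarrow> cyc_diff n g h < n"
  by (simp add: cyc_diff_def nat_less_iff)

lemma cyc_diff_inj_right:
  assumes "h < n" "h' < n" "cyc_diff n g h = cyc_diff n g h'"
  shows "h = h'"
proof -
  have "(int h - int g) mod int n = (int h' - int g) mod int n"
    using assms by (simp add: cyc_diff_def eq_nat_nat_iff)
  then have "int n dvd (int h - int g) - (int h' - int g)"
    by (simp only: mod_eq_dvd_iff)
  then have "int h mod int n = int h' mod int n" by (simp add: mod_eq_dvd_iff)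
  then show ?thesis using assms(1,2) by simp
qed

lemma cyc_diff_inj_left:
  assumes "g < n" "g' < n" "cyc_diff n g h = cyc_diff n g' h"
  shows "g = g'"
proof -
  have "(int h - int g) mod int n = (int h - int g') mod int n"
    using assms by (simp add: cyc_diff_def eq_nat_nat_iff)
  then have "int n dvd (int h - int g) - (int h - int g')"
    by (simp only: mod_eq_dvd_iff)
  then have "int g' mod int n = int g mod int n" by (simp add: mod_eq_dvd_iff)
  then show ?thesis using assms(1,2) by simp
qed

lemma bij_betw_man_ranks: "bij_betw (\<lambda>h. cyc_diff n g h + 1) {..<n} {1..n}"
proof -
  have inj: "inj_on (\<lambda>h. cyc_diff n g h + 1) {..<n}"
    by (auto intro!: inj_onI dest: cyc_diff_inj_right)
  have "(\<lambda>h. cyc_diff n g h + 1) ` {..<n} \<subseteq> {1..n}"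
    using cyc_diff_less[of n] by (auto simp: Suc_le_eq)
  with inj show ?thesis
    unfolding bij_betw_def by (intro conjI card_subset_eq) (simp_all only: card_image finite_atLeastAtMost
      card_lessThan card_atLeastAtMost diff_Suc_1 Suc_eq_plus1[symmetric])
qed

lemma bij_betw_woman_ranks: "bij_betw (\<lambda>g. n - cyc_diff n g h) {..<n} {1..n}"
proof -
  have inj: "inj_on (\<lambda>g. n - cyc_diff n g h) {..<n}"
  proof (rule inj_onI)
    fix a b assume a: "a \<in> {..<n}" "b \<in> {..<n}" "n - cyc_diff n a h = n - cyc_diff n b h"
    then have "cyc_diff n a h < n" "cyc_diff n b h < n" by (auto intro!: cyc_diff_less)
    with a(3) have "cyc_diff n a h = cyc_diff n b h" by linarith
    with a(1,2) show "a = b" by (auto dest: cyc_diff_inj_left)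
  qed
  have "(\<lambda>g. n - cyc_diff n g h) ` {..<n} \<subseteq> {1..n}"
    using cyc_diff_less[of n] by (auto simp: Suc_le_eq)
  with inj show ?thesis
    unfolding bij_betw_def by (intro conjI card_subset_eq) (simp_all only: card_image finite_atLeastAtMost
      card_lessThan card_atLeastAtMost diff_Suc_1 Suc_eq_plus1[symmetric])
qed

lemma wf_hollow_shell: "wf_instance (hollow_shell n)"
  by (simp add: wf_instance_def hollow_shell_def strict_pref_on_order_of_ranks
      bij_betw_imp_inj_on[OF bij_betw_man_ranks, simplified]
      bij_betw_imp_inj_on[OF bij_betw_woman_ranks])

lemma man_rank_hollow_shell:
  "h < n \<Longrightarrow> man_rank (hollow_shell n) g h = cyc_diff n g h + 1"
  unfolding man_rank_def hollow_shell_def sm_instance.simps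
  by (rule rank_in_order_of_ranks[OF bij_betw_man_ranks])

lemma woman_rank_hollow_shell:
  "g < n \<Longrightarrow> woman_rank (hollow_shell n) h g = n - cyc_diff n g h"
  unfolding woman_rank_def hollow_shell_def sm_instance.simps
  by (rule rank_in_order_of_ranks[OF bij_betw_woman_ranks])

definition polarized_matching :: "nat \<Rightarrow> nat \<Rightarrow> nat" where
  "polarized_matching n i =
     (let m = n div 2 in if i < m then i else if i = m then n - 1 else i - 1)"

end

theory Submission imports Defs begin

text \<open>A pair \<open>(i, j)\<close> blocks iff \<open>d(\<mu>\<inverse> j, j) < d(i, j) < d(i, \<mu> i)\<close>, where \<open>d = cyc_diff n\<close>.
  Under \<open>\<mu>\<^sup>*\<close> a man \<open>i < m\<close> has \<open>d(i, \<mu>\<^sup>* i) = 0\<close>, the least value, so he blocks with nobody;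
  a man \<open>i > m\<close> has the greatest value \<open>n - 1\<close>.  Each woman \<open>j < m\<close> has partner distance \<open>0\<close>, and
  each woman \<open>m \<le> j < n - 1\<close> has partner distance \<open>n - 1\<close>, so she blocks with nobody. For the
  matched pair \<open>(m, n - 1)\<close> the distance is \<open>n - 1 - m\<close>, less than \<open>d(m, j)\<close> for \<open>j < m\<close> and
  greater than \<open>d(i, n - 1)\<close> for \<open>i > m\<close>, so neither partner blocks.  If \<open>i > m > j\<close>, then
  \<open>i - j \<ge> 2\<close> gives \<open>0 < d(i, j) < n - 1\<close>, and the pair blocks.\<close>

text \<open>The integer difference lies strictly between \<open>- n\<close> and \<open>n\<close>, so
  adding \<open>n\<close> at most once gives the residue.\<close>

lemma cyc_diff_eq:
  assumes "g < n" "h < n"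
  shows "cyc_diff n g h = (if g \<le> h then h - g else n + h - g)"
proof (cases "g \<le> h")
  case True
  then have "(int h - int g) mod int n = int h - int g"
    using assms by (intro mod_pos_pos_trivial) auto
  with True show ?thesis by (simp add: cyc_diff_def)
next
  case False
  have "(int h - int g) mod int n = (int h - int g + int n) mod int n"
    by simp
  also have "\<dots> = int h - int g + int n"
    using False assms by (intro mod_pos_pos_trivial) auto
  finally show ?thesis using False assms by (simp add: cyc_diff_def)
qed

text \<open>Closed form that replaces the \<open>inv_into\<close> in \<open>man_of\<close>.\<close>

definition polarized_inverse :: "nat \<Rightarrow> nat \<Rightarrow> nat" where
  "polarized_inverse n j =
     (let m = n div 2 in if j < m then j else if j = n - 1 then m else j + 1)"

lemma polarized_inverse_left:
  "i < n \<Longrightarrow> polarized_inverse n (polarized_matching n i) = i"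
  by (auto simp: polarized_inverse_def polarized_matching_def Let_def)

lemma polarized_inverse_right:
  "j < n \<Longrightarrow> polarized_matching n (polarized_inverse n j) = j"
  by (auto simp: polarized_inverse_def polarized_matching_def Let_def)

lemma polarized_matching_less: "i < n \<Longrightarrow> polarized_matching n i < n"
  by (auto simp: polarized_matching_def Let_def)

lemma polarized_inverse_less: "j < n \<Longrightarrow> polarized_inverse n j < n"
  by (auto simp: polarized_inverse_def Let_def)

lemma bij_betw_polarized_matching: "bij_betw (polarized_matching n) {..<n} {..<n}"
  by (rule bij_betw_byWitness[where f' = "polarized_inverse n"])
    (auto simp: polarized_inverse_left polarized_inverse_right
      polarized_matching_less polarized_inverse_less)

lemma complete_matching_polarized:
  "complete_matching (hollow_shell n) (polarized_matching n)"
  by (simp add: complete_matching_def hollow_shell_def bij_betw_polarized_matching)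

lemma man_of_polarized:
  assumes "j < n"
  shows "man_of (hollow_shell n) (polarized_matching n) j = polarized_inverse n j"
  using assms bij_betw_imp_inj_on[OF bij_betw_polarized_matching]
  by (simp add: man_of_def hollow_shell_def inv_into_f_eq polarized_inverse_less
      polarized_inverse_right)

lemma cyc_diff_polarized_matching:
  assumes "i < n"
  shows "cyc_diff n i (polarized_matching n i) =
    (if i < n div 2 then 0 else if i = n div 2 then n - 1 - n div 2 else n - 1)"
  using assms polarized_matching_less[OF assms]
  by (auto simp: cyc_diff_eq polarized_matching_def Let_def)

lemma cyc_diff_polarized_inverse:
  assumes "j < n"
  shows "cyc_diff n (polarized_inverse n j) j =
    (if j < n div 2 then 0 else if j = n - 1 then n - 1 - n div 2 else n - 1)"
  using assms polarized_inverse_less[OF assms]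
  by (auto simp: cyc_diff_eq polarized_inverse_def Let_def)

lemma blocks_polarized_iff:
  assumes "i < n" "j < n"
  shows "(i, j) \<in> blocking_pairs (hollow_shell n) (polarized_matching n) \<longleftrightarrow>
    cyc_diff n (polarized_inverse n j) j < cyc_diff n i j \<and>
    cyc_diff n i j < cyc_diff n i (polarized_matching n i)"
proof -
  \<comment> \<open>These bounds let the truncated subtraction in the women's ranks
    \<open>n - d\<close> be cancelled, reversing the inequality.\<close>
  have "cyc_diff n i j < n" "cyc_diff n (polarized_inverse n j) j < n"
    using assms by (auto intro: cyc_diff_less)
  then show ?thesis
    using assms man_of_polarized[OF assms(2)]
    by (auto simp: blocking_pairs_def order_of_ranks_def hollow_shell_def
        polarized_matching_less polarized_inverse_less)
qed

lemma blocking_pairs_polarized: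
  assumes "n \<ge> 1"
  shows "blocking_pairs (hollow_shell n) (polarized_matching n) =
    {n div 2 + 1..n - 1} \<times> {0..<n div 2}"
proof -
  have "(i, j) \<in> blocking_pairs (hollow_shell n) (polarized_matching n) \<longleftrightarrow>
      n div 2 < i \<and> j < n div 2" if "i < n" "j < n" for i j
    \<comment> \<open>All distances become piecewise linear in \<open>i\<close> and
      \<open>j\<close>, so linear arithmetic decides each case.\<close>
    unfolding blocks_polarized_iff[OF that] cyc_diff_polarized_matching[OF that(1)]
      cyc_diff_polarized_inverse[OF that(2)] cyc_diff_eq[OF that]
    using that by auto
  moreover have "i < n \<and> j < n"
    if "(i, j) \<in> blocking_pairs (hollow_shell n) (polarized_matching n)" for i j
    using that by (simp add: blocking_pairs_def hollow_shell_def)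
  moreover have "i \<in> {n div 2 + 1..n - 1} \<and> j \<in> {0..<n div 2} \<longleftrightarrow>
      i < n \<and> j < n \<and> n div 2 < i \<and> j < n div 2" for i j
    using assms by auto
  ultimately show ?thesis by (intro set_eqI) (metis mem_Sigma_iff surj_pair)
qed

lemma half_product_eq: "n div 2 * (n - 1 - n div 2) = (n - 1)\<^sup>2 div 4" for n :: nat
proof (cases "even n")
  case True
  show ?thesis
  proof (cases "n = 0")
    case False
    with True obtain k where "n = 2 * Suc k"
      by (metis evenE mult_0_right not0_implies_Suc)
    then have "n - 1 = 2 * k + 1" "n div 2 = Suc k" by auto
    \<comment> \<open>The remainder 1 is what the floor discards; for odd \<open>n\<close> the
      division by 4 is exact.\<close>
    moreover have "(2 * k + 1)\<^sup>2 = 4 * (Suc k * k) + 1"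
      by (simp add: power2_eq_square algebra_simps)
    ultimately show ?thesis by simp
  qed simp
next
  case False
  then obtain k where "n = 2 * k + 1" by (elim oddE)
  then show ?thesis by (simp add: power2_eq_square)
qed

theorem theorem5p3:
  fixes n m :: nat
  assumes "n \<ge> 1" and "m = n div 2"
  shows "num_blocking (hollow_shell n) (polarized_matching n) = m * (n - 1 - m)
    \<and> m * (n - 1 - m) = (n - 1)\<^sup>2 div 4
    \<and> max_blocking (hollow_shell n) \<ge> (n - 1)\<^sup>2 div 4
    \<and> blocking_pairs (hollow_shell n) (polarized_matching n) = {m + 1..n - 1} \<times> {0..<m}"
proof -
  have blocking: "blocking_pairs (hollow_shell n) (polarized_matching n) =
      {m + 1..n - 1} \<times> {0..<m}"
    using blocking_pairs_polarized assms by simp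
  then have num: "num_blocking (hollow_shell n) (polarized_matching n) = m * (n - 1 - m)"
    by (simp add: num_blocking_def card_cartesian_product)
  have half: "m * (n - 1 - m) = (n - 1)\<^sup>2 div 4"
    using half_product_eq assms(2) by simp
  have "num_blocking (hollow_shell n) (polarized_matching n) \<le> max_blocking (hollow_shell n)"
    unfolding max_blocking_def
    using complete_matching_polarized by (intro Max_ge finite_num_blocking_values) blast
  with blocking num half show ?thesis by simp
qed

end
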